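(* Let $(X,(\cdot,\cdot),\|\cdot\|)$ be a (real or complex) infinite-dimensional separable Hilbert space with an orthonormal basis $\{e_n\}_{n\in\mathbb{N}}$. Then, for every sequence $(x_n)_{n\in\mathbb{N}}$ in $X$ and every vector $x\in X$, one has $x_n\to x$ in $X$ as $n\to\infty$ if and only if both of the following conditions hold: (1) for every $k\in\mathbb{N}$, $(x_n,e_k)\to(x,e_k)$ as $n\to\infty$; and (2) for every $\varepsilon>0$ there exists $K\in\mathbb{N}$ such that for all $n\in\mathbb{N}$, $\sum_{k=K+1}^\infty |(x_n,e_k)|^2<\varepsilon$.
   Context: $\mathbb{N}=\{1,2,\dots\}$; $(\cdot,\cdot)$ denotes the inner product of $X$ and $\|\cdot\|$ the norm induced by it. Convergence $x_n\to x$ is convergence in this norm. *)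

theory Defs
  imports "HOL-Analysis.Analysis"
begin

text \<open>
  HOL-Analysis has real inner product spaces (class \<open>real_inner\<close>), but no complex ones.
  The following class is the complex counterpart. The inner product is linear in the first
  and conjugate-linear in the second argument. Basing the class on \<open>real_normed_vector\<close> makes
  norm, metric and topology the library's ones; the last axiom says that the norm is the one
  induced by the inner product.
\<close>

class complex_inner = real_normed_vector +
  fixes scaleC :: "complex \<Rightarrow> 'a \<Rightarrow> 'a" (infixr \<open>*\<^sub>C\<close> 75)
    and cinner :: "'a \<Rightarrow> 'a \<Rightarrow> complex"
  assumes scaleC_add_right: "a *\<^sub>C (x + y) = a *\<^sub>C x + a *\<^sub>C y"
    and scaleC_add_left: "(a + b) *\<^sub>C x = a *\<^sub>C x + b *\<^sub>C x"
    and scaleC_scaleC: "a *\<^sub>C b *\<^sub>C x = (a * b) *\<^sub>C x"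
    and scaleC_one: "1 *\<^sub>C x = x"
    and scaleR_eq_scaleC: "r *\<^sub>R x = complex_of_real r *\<^sub>C x"
    and cinner_commute: "cinner x y = cnj (cinner y x)"
    and cinner_add_left: "cinner (x + y) z = cinner x z + cinner y z"
    and cinner_scaleC_left: "cinner (a *\<^sub>C x) y = a * cinner x y"
    and cinner_ge_zero: "0 \<le> Re (cinner x x)"
    and cinner_eq_zero_iff: "cinner x x = 0 \<longleftrightarrow> x = 0"
    and norm_eq_sqrt_cinner: "norm x = sqrt (Re (cinner x x))"

global_interpretation complex_vector: vector_space "scaleC :: complex \<Rightarrow> 'a \<Rightarrow> 'a::complex_inner"
  defines cspan = complex_vector.span
  by unfold_locales
    (simp_all add: scaleC_add_right scaleC_add_left scaleC_scaleC scaleC_one)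

definition orthonormal_basis :: "'i set \<Rightarrow> ('i \<Rightarrow> 'a::real_inner) \<Rightarrow> bool" where
  "orthonormal_basis I e \<longleftrightarrow>
     (\<forall>i\<in>I. \<forall>j\<in>I. inner (e i) (e j) = (if i = j then 1 else 0)) \<and>
     closure (span (e ` I)) = UNIV"

definition corthonormal_basis :: "'i set \<Rightarrow> ('i \<Rightarrow> 'a::complex_inner) \<Rightarrow> bool" where
  "corthonormal_basis I e \<longleftrightarrow>
     (\<forall>i\<in>I. \<forall>j\<in>I. cinner (e i) (e j) = (if i = j then 1 else 0)) \<and>
     closure (cspan (e ` I)) = UNIV"

end

theory Submission
  imports Defs
begin

text \<open>
  Both directions rest on Parseval's identity, which writes the squared distance of \<open>x\<^sub>n\<close> and \<open>x\<close>
  as a finite sum over \<open>k \<le> K\<close>, controlled by (1), plus a tail. The tail of a difference is at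
  most twice the sum of the two tails, so it is controlled by (2) and the tail of \<open>x\<close>; the same
  inequality yields (2) from convergence, up to finitely many indices \<open>n\<close>.
\<close>

section \<open>Inner product algebra over an abstract scalar field\<close>

text \<open>The scalar field is kept abstract, with conjugation \<open>cj\<close>, to treat \<open>real\<close> and \<open>complex\<close> at once.\<close>

locale hermitian_space = vector_space scale
  for scale :: "'k::real_normed_field \<Rightarrow> 'v::real_normed_vector \<Rightarrow> 'v" (infixr \<open>\<cdot>\<close> 75) +
  fixes ip :: "'v \<Rightarrow> 'v \<Rightarrow> 'k" and cj :: "'k \<Rightarrow> 'k"
  assumes cj_add: "cj (a + b) = cj a + cj b"
    and cj_mult: "cj (a * b) = cj a * cj b"
    and mult_cj: "a * cj a = of_real ((norm a)\<^sup>2)"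
    and ip_commute: "ip x y = cj (ip y x)"
    and ip_add_left: "ip (x + y) z = ip x z + ip y z"
    and ip_scale_left: "ip (a \<cdot> x) y = a * ip x y"
    and ip_self: "ip x x = of_real ((norm x)\<^sup>2)"
begin

lemma ip_zero_left [simp]: "ip 0 y = 0"
  using ip_add_left[of 0 0 y] by simp

lemma ip_diff_left: "ip (x - y) z = ip x z - ip y z"
  using ip_add_left[of "x - y" y z] by simp

lemma ip_sum_left: "ip (\<Sum>i\<in>F. f i) z = (\<Sum>i\<in>F. ip (f i) z)"
  by (induction F rule: infinite_finite_induct) (simp_all add: ip_add_left)

lemma ip_zero_right [simp]: "ip x 0 = 0"
  \<comment> \<open>Additivity forces \<open>cj 0 = 0\<close>.\<close>
  using cj_add[of 0 0] ip_commute[of x 0] by simp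

lemma ip_add_right: "ip x (y + z) = ip x y + ip x z"
  by (metis cj_add ip_add_left ip_commute)

lemma ip_scale_right: "ip x (a \<cdot> y) = cj a * ip x y"
  by (metis cj_mult ip_scale_left ip_commute)

lemma ip_sum_right: "ip z (\<Sum>i\<in>F. f i) = (\<Sum>i\<in>F. ip z (f i))"
  by (induction F rule: infinite_finite_induct) (simp_all add: ip_add_right)

lemma pythagoras:
  assumes "ip x y = 0"
  shows "(norm (x + y))\<^sup>2 = (norm x)\<^sup>2 + (norm y)\<^sup>2"
proof -
  have "ip y x = 0"
    using assms ip_commute[of y x] ip_commute[of x 0] by simp
  then have "ip (x + y) (x + y) = ip x x + ip y y"
    using assms by (simp add: ip_add_left ip_add_right)
  \<comment> \<open>\<open>ip_self\<close> places the squared norm in the scalar field; injectivity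
    of \<open>of_real\<close> brings the equation back to the reals.\<close>
  then have "of_real ((norm (x + y))\<^sup>2) = (of_real ((norm x)\<^sup>2 + (norm y)\<^sup>2) :: 'k)"
    unfolding ip_self by simp
  then show ?thesis
    by (simp only: of_real_eq_iff)
qed

end

section \<open>Orthonormal bases: finite projections, Bessel and Parseval\<close>

locale hermitian_basis = hermitian_space scale ip cj
  for scale :: "'k::real_normed_field \<Rightarrow> 'v::real_normed_vector \<Rightarrow> 'v" (infixr \<open>\<cdot>\<close> 75)
    and ip :: "'v \<Rightarrow> 'v \<Rightarrow> 'k" and cj :: "'k \<Rightarrow> 'k" +
  fixes I :: "'i set" and e :: "'i \<Rightarrow> 'v"
  assumes ortho: "i \<in> I \<Longrightarrow> j \<in> I \<Longrightarrow> ip (e i) (e j) = (if i = j then 1 else 0)"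
    and dense: "closure (span (e ` I)) = UNIV"
begin

definition proj :: "'i set \<Rightarrow> 'v \<Rightarrow> 'v" where
  "proj F x = (\<Sum>k\<in>F. ip x (e k) \<cdot> e k)"

lemma proj_add: "proj F (x + y) = proj F x + proj F y"
  by (simp add: proj_def ip_add_left scale_left_distrib sum.distrib)

lemma proj_diff: "proj F (x - y) = proj F x - proj F y"
  using proj_add[of F "x - y" y] by simp

lemma proj_scale: "proj F (a \<cdot> x) = a \<cdot> proj F x"
  by (simp add: proj_def ip_scale_left scale_sum_right)

lemma proj_basis:
  assumes "finite F" "F \<subseteq> I" "i \<in> F"
  shows "proj F (e i) = e i"
proof -
  have "proj F (e i) = (\<Sum>k\<in>F. if i = k then e k else 0)"
    unfolding proj_def using assms by (intro sum.cong refl) (auto simp: ortho subset_iff)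
  then show ?thesis
    using assms by simp
qed

lemma ip_proj:
  assumes "finite F" "F \<subseteq> I" "i \<in> F"
  shows "ip (proj F x) (e i) = ip x (e i)"
proof -
  have "ip (proj F x) (e i) = (\<Sum>k\<in>F. if k = i then ip x (e k) else 0)"
    unfolding proj_def ip_sum_left ip_scale_left
    using assms by (intro sum.cong refl) (auto simp: ortho subset_iff)
  then show ?thesis
    using assms by simp
qed

text \<open>The residual \<open>x - proj F x\<close> is orthogonal to every \<open>e k\<close> with
  \<open>k\<close> in \<open>F\<close>, hence to \<open>proj F x\<close>, so Pythagoras applies;
  orthonormality turns the norm of the projection into the sum of squares.\<close>

lemma bessel_identity:
  assumes F: "finite F" "F \<subseteq> I"
  shows "(norm x)\<^sup>2 = (\<Sum>k\<in>F. (norm (ip x (e k)))\<^sup>2) + (norm (x - proj F x))\<^sup>2"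
proof -
  have "ip (x - proj F x) (proj F x) = (\<Sum>k\<in>F. cj (ip x (e k)) * ip (x - proj F x) (e k))"
    by (subst (2) proj_def) (simp add: ip_sum_right ip_scale_right)
  also have "\<dots> = 0"
    using F by (simp add: ip_diff_left ip_proj)
  finally have 1: "(norm x)\<^sup>2 = (norm (x - proj F x))\<^sup>2 + (norm (proj F x))\<^sup>2"
    using pythagoras by fastforce
  have "ip (proj F x) (proj F x) = (\<Sum>k\<in>F. cj (ip x (e k)) * ip (proj F x) (e k))"
    by (subst (2) proj_def) (simp add: ip_sum_right ip_scale_right)
  also have "\<dots> = (\<Sum>k\<in>F. ip x (e k) * cj (ip x (e k)))"
    using F by (intro sum.cong refl) (simp add: ip_proj mult.commute)
  finally have "of_real ((norm (proj F x))\<^sup>2) = (of_real (\<Sum>k\<in>F. (norm (ip x (e k)))\<^sup>2) :: 'k)"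
    unfolding ip_self mult_cj of_real_sum .
  then have "(norm (proj F x))\<^sup>2 = (\<Sum>k\<in>F. (norm (ip x (e k)))\<^sup>2)"
    by (simp only: of_real_eq_iff)
  with 1 show ?thesis
    by simp
qed

text \<open>A vector of the span involves only finitely many basis vectors, each fixed by any
  projection whose index set contains it. Allowing every larger \<open>G\<close> keeps the induction
  going and fits the filter \<open>finite_subsets_at_top\<close>.\<close>

lemma proj_span:
  assumes "u \<in> span (e ` I)"
  shows "\<exists>F. finite F \<and> F \<subseteq> I \<and> (\<forall>G. finite G \<and> F \<subseteq> G \<and> G \<subseteq> I \<longrightarrow> proj G u = u)"
  using assms
proof (induction rule: span_induct_alt)
  case base
  show ?case
    by (intro exI[of _ "{}"]) (simp add: proj_def)
next
  case (step a b u)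
  then obtain i F where "i \<in> I" "b = e i" and F: "finite F" "F \<subseteq> I"
    "\<forall>G. finite G \<and> F \<subseteq> G \<and> G \<subseteq> I \<longrightarrow> proj G u = u"
    by auto
  then show ?case
    by (intro exI[of _ "insert i F"]) (auto simp: proj_add proj_scale proj_basis)
qed

text \<open>Density gives a span vector \<open>u\<close> near \<open>x\<close>. Once
  \<open>proj G\<close> fixes \<open>u\<close>, the residuals of \<open>x\<close> and
  \<open>x - u\<close> coincide, and Bessel bounds the latter by the norm of
  \<open>x - u\<close>.\<close>

theorem parseval: "((\<lambda>k. (norm (ip x (e k)))\<^sup>2) has_sum (norm x)\<^sup>2) I"
  unfolding has_sum_def
proof (rule tendstoI)
  fix \<epsilon> :: real
  assume "\<epsilon> > 0"
  have "x \<in> closure (span (e ` I))"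
    by (simp add: dense)
  \<comment> \<open>The square root appears because the defect of a partial sum is a squared
    norm.\<close>
  then obtain u where u: "u \<in> span (e ` I)" "dist u x < sqrt \<epsilon>"
    unfolding closure_approachable using real_sqrt_gt_zero[OF \<open>\<epsilon> > 0\<close>] by blast
  from proj_span[OF u(1)] obtain F where F: "finite F" "F \<subseteq> I"
    "\<forall>G. finite G \<and> F \<subseteq> G \<and> G \<subseteq> I \<longrightarrow> proj G u = u"
    by auto
  have "dist (\<Sum>k\<in>G. (norm (ip x (e k)))\<^sup>2) ((norm x)\<^sup>2) < \<epsilon>"
    if G: "finite G" "F \<subseteq> G" "G \<subseteq> I" for G
  proof -
    have eq: "x - proj G x = (x - u) - proj G (x - u)"
      using F(3) G by (simp add: proj_diff)
    have "(norm (x - proj G x))\<^sup>2 \<le> (norm (x - u))\<^sup>2"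
      using bessel_identity[OF G(1,3), of "x - u"] unfolding eq
      by (simp add: sum_nonneg)
    also have "\<dots> < (sqrt \<epsilon>)\<^sup>2"
      using u(2) by (intro power_strict_mono) (simp_all add: dist_norm norm_minus_commute)
    also have "\<dots> = \<epsilon>"
      using \<open>\<epsilon> > 0\<close> by simp
    finally show ?thesis
      using bessel_identity[OF G(1,3), of x] by (simp add: dist_real_def)
  qed
  then show "\<forall>\<^sub>F G in finite_subsets_at_top I. dist (\<Sum>k\<in>G. (norm (ip x (e k)))\<^sup>2) ((norm x)\<^sup>2) < \<epsilon>"
    unfolding eventually_finite_subsets_at_top using F(1,2) by blast
qed

text \<open>Cauchy-Schwarz against a unit vector, read off from Bessel's identity for a
  singleton.\<close>

lemma norm_ip_le:
  assumes "k \<in> I"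
  shows "norm (ip x (e k)) \<le> norm x"
  using bessel_identity[of "{k}" x] assms
  by (auto intro: power2_le_imp_le)

end

section \<open>Tails of the coefficient series\<close>

locale hermitian_basis_seq = hermitian_basis scale ip cj "{1..}" e
  for scale :: "'k::real_normed_field \<Rightarrow> 'v::real_normed_vector \<Rightarrow> 'v"
    and ip :: "'v \<Rightarrow> 'v \<Rightarrow> 'k" and cj :: "'k \<Rightarrow> 'k" and e :: "nat \<Rightarrow> 'v"
begin

definition tail :: "nat \<Rightarrow> 'v \<Rightarrow> real" where
  "tail K x = (\<Sum>\<^sub>\<infinity>k\<in>{K+1..}. (norm (ip x (e k)))\<^sup>2)"

lemma summable_tail: "(\<lambda>k. (norm (ip x (e k)))\<^sup>2) summable_on {K+1..}"
  by (rule summable_on_subset_banach[OF has_sum_imp_summable[OF parseval[of x]]]) auto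

lemma tail_nonneg: "tail K x \<ge> 0"
  unfolding tail_def by (rule infsum_nonneg) simp

lemma parseval_split: "(norm x)\<^sup>2 = (\<Sum>k=1..K. (norm (ip x (e k)))\<^sup>2) + tail K x"
proof -
  have "((\<lambda>k. (norm (ip x (e k)))\<^sup>2) has_sum (\<Sum>k=1..K. (norm (ip x (e k)))\<^sup>2) + tail K x)
          ({1..K} \<union> {K+1..})"
    unfolding tail_def
    by (intro has_sum_Un_disjoint has_sum_finite has_sum_infsum summable_tail) auto
  moreover have "{1..K} \<union> {K+1..} = {1..}"
    by auto
  ultimately show ?thesis
    using has_sum_unique[OF parseval[of x]] by simp
qed

lemma tail_le_norm: "tail K x \<le> (norm x)\<^sup>2"
  using parseval_split[of x K] by (simp add: sum_nonneg)

lemma tail_antimono: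
  assumes "K \<le> L"
  shows "tail L x \<le> tail K x"
  unfolding tail_def using assms
  by (intro infsum_mono_neutral summable_tail) auto

lemma tail_uminus: "tail K (- x) = tail K x"
  unfolding tail_def using ip_diff_left[of 0 x] by simp

text \<open>Termwise from \<open>2 * a * b \<le> a^2 + b^2\<close>, which avoids square roots of
  tails.\<close>

lemma tail_diff_le: "tail K (x - y) \<le> 2 * tail K x + 2 * tail K y"
proof -
  have "tail K (x - y) \<le>
    (\<Sum>\<^sub>\<infinity>k\<in>{K+1..}. 2 * (norm (ip x (e k)))\<^sup>2 + 2 * (norm (ip y (e k)))\<^sup>2)"
    unfolding tail_def
  proof (intro infsum_mono summable_tail summable_on_add summable_on_cmult_right)
    fix k
    have "(norm (ip (x - y) (e k)))\<^sup>2 \<le> (norm (ip x (e k)) + norm (ip y (e k)))\<^sup>2"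
      by (simp add: ip_diff_left norm_triangle_ineq4 power_mono)
    also have "\<dots> \<le> 2 * (norm (ip x (e k)))\<^sup>2 + 2 * (norm (ip y (e k)))\<^sup>2"
      using sum_squares_bound[of "norm (ip x (e k))" "norm (ip y (e k))"]
      by (simp add: power2_sum)
    finally show "(norm (ip (x - y) (e k)))\<^sup>2 \<le> \<dots>" .
  qed
  also have "\<dots> = 2 * tail K x + 2 * tail K y"
    unfolding tail_def
    by (simp only: infsum_add summable_tail summable_on_cmult_right infsum_cmult_right')
  finally show ?thesis .
qed

text \<open>Some finite set \<open>F\<close> almost exhausts the Parseval sum. As soon as
  \<open>{1..K}\<close> contains \<open>F\<close>, the head does at least as well, and the tail is
  what is missing.\<close>

lemma tail_tendsto_0: "(\<lambda>K. tail K x) \<longlonglongrightarrow> 0"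
proof (rule order_tendstoI)
  fix \<epsilon> :: real
  assume "0 < \<epsilon>"
  then have "\<forall>\<^sub>F F in finite_subsets_at_top {1..}.
      dist (\<Sum>k\<in>F. (norm (ip x (e k)))\<^sup>2) ((norm x)\<^sup>2) < \<epsilon>"
    using parseval[of x] tendstoD unfolding has_sum_def by blast
  then obtain F where F: "finite F" "F \<subseteq> {1..}"
      "dist (\<Sum>k\<in>F. (norm (ip x (e k)))\<^sup>2) ((norm x)\<^sup>2) < \<epsilon>"
    unfolding eventually_finite_subsets_at_top by blast
  from F(1) obtain N where N: "F \<subseteq> {..N}"
    using finite_nat_iff_bounded_le by blast
  have "tail K x < \<epsilon>" if "K \<ge> N" for K
  proof -
    have "(\<Sum>k\<in>F. (norm (ip x (e k)))\<^sup>2) \<le> (\<Sum>k=1..K. (norm (ip x (e k)))\<^sup>2)"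
      using F(2) N that by (intro sum_mono2) (auto simp: subset_iff simp del: One_nat_def)
    then show ?thesis
      using F(3) parseval_split[of x K] unfolding dist_real_def by linarith
  qed
  then show "\<forall>\<^sub>F K in sequentially. tail K x < \<epsilon>"
    using eventually_sequentially by blast
\<comment> \<open>The lower half of the order limit: any bound below 0 lies below a nonnegative
  tail.\<close>
qed (auto intro: always_eventually less_le_trans[OF _ tail_nonneg])

text \<open>All later cutoffs are included so that several thresholds can be merged by a
  maximum.\<close>

lemma tail_eventually_less:
  assumes "\<epsilon> > 0"
  obtains K where "K \<ge> 1" "\<And>L. L \<ge> K \<Longrightarrow> tail L x < \<epsilon>"
proof -
  obtain N where "\<And>L. L \<ge> N \<Longrightarrow> tail L x < \<epsilon>"
    using order_tendstoD(2)[OF tail_tendsto_0 assms, of x] unfolding eventually_sequentially by blast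
  then show thesis
    by (intro that[of "max 1 N"]) auto
qed

section \<open>The two implications for a sequence\<close>

lemma tendsto_ip:
  assumes "xs \<longlonglongrightarrow> x" "k \<ge> 1"
  shows "(\<lambda>n. ip (xs n) (e k)) \<longlonglongrightarrow> ip x (e k)"
proof (rule LIM_zero_cancel, rule Lim_null_comparison)
  show "\<forall>\<^sub>F n in sequentially. norm (ip (xs n) (e k) - ip x (e k)) \<le> norm (xs n - x)"
    using norm_ip_le[of k] assms(2) by (simp flip: ip_diff_left)
  show "(\<lambda>n. norm (xs n - x)) \<longlonglongrightarrow> 0"
    using assms(1) by (intro tendsto_norm_zero LIM_zero)
qed

text \<open>Late terms are close to \<open>x\<close> and inherit its cutoff; the finitely many early
  terms have cutoffs of their own, and a maximum serves all.\<close>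

lemma tail_uniform:
  assumes lim: "xs \<longlonglongrightarrow> x" and "\<epsilon> > 0"
  shows "\<exists>K\<ge>1. \<forall>n. tail K (xs n) < \<epsilon>"
proof -
  have "(\<lambda>n. (norm (xs n - x))\<^sup>2) \<longlonglongrightarrow> 0"
    using tendsto_power[OF tendsto_norm_zero[OF LIM_zero[OF lim]], of 2] by simp
  \<comment> \<open>A quarter each for the distance and for the tail of \<open>x\<close>, since
    \<open>tail_diff_le\<close> doubles both.\<close>
  then have "\<forall>\<^sub>F n in sequentially. (norm (xs n - x))\<^sup>2 < \<epsilon> / 4"
    by (rule order_tendstoD) (use \<open>\<epsilon> > 0\<close> in simp)
  then obtain N where N: "\<And>n. n \<ge> N \<Longrightarrow> (norm (xs n - x))\<^sup>2 < \<epsilon> / 4"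
    unfolding eventually_sequentially by blast
  obtain K where K: "K \<ge> 1" "\<And>L. L \<ge> K \<Longrightarrow> tail L x < \<epsilon> / 4"
    using \<open>\<epsilon> > 0\<close> by (rule_tac tail_eventually_less[of "\<epsilon> / 4" x]) auto
  have "\<forall>n. \<exists>M. \<forall>L\<ge>M. tail L (xs n) < \<epsilon>"
    by (meson tail_eventually_less \<open>\<epsilon> > 0\<close>)
  then obtain M where M: "\<And>n L. L \<ge> M n \<Longrightarrow> tail L (xs n) < \<epsilon>"
    by metis
  define L where "L = Max (insert K (M ` {..<N}))"
  have LK: "L \<ge> K"
    unfolding L_def by simp
  have "tail L (xs n) < \<epsilon>" for n
  proof (cases "n < N")
    case True
    then show ?thesis
      by (intro M) (simp add: L_def)
  next
    case False
    \<comment> \<open>Here \<open>xs n\<close> is read as the difference of \<open>xs n - x\<close>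
      and \<open>- x\<close>.\<close>
    have "tail L (xs n) \<le> 2 * tail L (xs n - x) + 2 * tail L x"
      using tail_diff_le[of L "xs n - x" "- x"] tail_uminus[of L x] by simp
    then show ?thesis
      using tail_le_norm[of L "xs n - x"] N[of n] K(2)[OF LK] False by simp
  qed
  then show ?thesis
    using LK K(1) by (intro exI[of _ L]) auto
qed

text \<open>The cutoff is fixed before \<open>n\<close> grows: the head is then a finite sum of null
  sequences, while the tail is bounded uniformly in \<open>n \<ge> 1\<close>.\<close>

lemma tendsto_of_tail_uniform:
  assumes lim: "\<And>k. k \<ge> 1 \<Longrightarrow> (\<lambda>n. ip (xs n) (e k)) \<longlonglongrightarrow> ip x (e k)"
    and tails: "\<And>\<epsilon>. \<epsilon> > 0 \<Longrightarrow> \<exists>K\<ge>1. \<forall>n\<ge>1. tail K (xs n) < \<epsilon>"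
  shows "xs \<longlonglongrightarrow> x"
proof (rule LIM_zero_cancel, rule tendsto_norm_zero_cancel, rule order_tendstoI)
  fix \<epsilon> :: real
  assume "0 < \<epsilon>"
  \<comment> \<open>Five portions: one for the head, and two for each of the tails of
    \<open>xs n\<close> and \<open>x\<close>.\<close>
  define \<delta> where "\<delta> = \<epsilon>\<^sup>2 / 5"
  have \<delta>: "\<delta> > 0"
    using \<open>0 < \<epsilon>\<close> by (simp add: \<delta>_def)
  obtain K1 where K1: "\<And>n. n \<ge> 1 \<Longrightarrow> tail K1 (xs n) < \<delta>"
    using tails[OF \<delta>] by blast
  obtain K2 where K2: "\<And>L. L \<ge> K2 \<Longrightarrow> tail L x < \<delta>"
    using tail_eventually_less[OF \<delta>] by blast
  define K where "K = max K1 K2"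
  have "(\<lambda>n. \<Sum>k=1..K. (norm (ip (xs n) (e k) - ip x (e k)))\<^sup>2) \<longlonglongrightarrow> (\<Sum>k=1..K. (norm (0::'k))\<^sup>2)"
    by (intro tendsto_sum tendsto_power tendsto_norm LIM_zero lim) simp
  then have "(\<lambda>n. \<Sum>k=1..K. (norm (ip (xs n) (e k) - ip x (e k)))\<^sup>2) \<longlonglongrightarrow> 0"
    by simp
  then have "\<forall>\<^sub>F n in sequentially. (\<Sum>k=1..K. (norm (ip (xs n) (e k) - ip x (e k)))\<^sup>2) < \<delta>"
    by (rule order_tendstoD) (rule \<delta>)
  \<comment> \<open>The uniform tail bound speaks only of indices from 1 on, so index 0 is
    discarded.\<close>
  with eventually_ge_at_top[of 1] show "\<forall>\<^sub>F n in sequentially. norm (xs n - x) < \<epsilon>"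
  proof eventually_elim
    case (elim n)
    have "tail K (xs n) < \<delta>"
      using tail_antimono[of K1 K "xs n"] K1[of n] elim(1) by (simp add: K_def)
    moreover have "tail K x < \<delta>"
      by (intro K2) (simp add: K_def)
    ultimately have "(norm (xs n - x))\<^sup>2 < \<epsilon>\<^sup>2"
      using parseval_split[of "xs n - x" K] tail_diff_le[of K "xs n" x] elim(2)
      by (simp add: \<delta>_def ip_diff_left)
    then show ?case
      using \<open>0 < \<epsilon>\<close> by (auto intro: power_less_imp_less_base)
  qed
qed (auto intro: always_eventually less_le_trans[OF _ norm_ge_zero])

theorem tendsto_iff:
  "xs \<longlonglongrightarrow> x \<longleftrightarrow>
     (\<forall>k\<ge>1. (\<lambda>n. ip (xs n) (e k)) \<longlonglongrightarrow> ip x (e k)) \<and>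
     (\<forall>\<epsilon>>0. \<exists>K\<ge>1. \<forall>n\<ge>1. (\<Sum>\<^sub>\<infinity>k\<in>{K+1..}. (norm (ip (xs n) (e k)))\<^sup>2) < \<epsilon>)"
  (is "_ \<longleftrightarrow> ?coords \<and> ?tails")
proof (intro iffI conjI)
  assume "xs \<longlonglongrightarrow> x"
  then show ?coords ?tails
    using tendsto_ip tail_uniform unfolding tail_def by blast+
next
  assume "?coords \<and> ?tails"
  then show "xs \<longlonglongrightarrow> x"
    by (intro tendsto_of_tail_uniform) (auto simp: tail_def)
qed

end

section \<open>The real and complex instances\<close>

lemma hermitian_space_real:
  "hermitian_space (scaleR :: real \<Rightarrow> 'a::real_inner \<Rightarrow> 'a) inner id"
proof unfold_locales
  fix x y :: 'a
  show "inner x y = id (inner y x)"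
    by (simp add: inner_commute)
qed (simp_all add: scaleR_add_right scaleR_add_left inner_add_left power2_norm_eq_inner
      flip: power2_eq_square)

lemma hermitian_space_complex:
  "hermitian_space (scaleC :: complex \<Rightarrow> 'a::complex_inner \<Rightarrow> 'a) cinner cnj"
proof unfold_locales
  fix x :: 'a
  \<comment> \<open>The norm axiom sees only the real part; conjugate symmetry removes the imaginary
    part.\<close>
  have "Im (cinner x x) = 0"
    using arg_cong[OF cinner_commute[of x x], of Im] by simp
  then show "cinner x x = of_real ((norm x)\<^sup>2)"
    by (simp add: norm_eq_sqrt_cinner cinner_ge_zero complex_eq_iff)
qed (rule cinner_commute complex_norm_square[symmetric]
      | simp add: cinner_add_left cinner_scaleC_left)+

theorem corollary4p1:
  shows
    "(\<forall>(e :: nat \<Rightarrow> 'a::{real_inner, complete_space}).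
       (\<nexists>B :: 'a set. finite B \<and> span B = UNIV) \<and>
       separable_space (euclidean :: 'a topology) \<and>
       orthonormal_basis {1..} e \<longrightarrow>
       (\<forall>(xs :: nat \<Rightarrow> 'a) (x :: 'a).
         xs \<longlonglongrightarrow> x \<longleftrightarrow>
           (\<forall>k\<ge>1. (\<lambda>n. inner (xs n) (e k)) \<longlonglongrightarrow> inner x (e k)) \<and>
           (\<forall>\<epsilon>>0. \<exists>K\<ge>1. \<forall>n\<ge>1. (\<Sum>\<^sub>\<infinity>k\<in>{K+1..}. \<bar>inner (xs n) (e k)\<bar>\<^sup>2) < \<epsilon>)))
     \<and>
     (\<forall>(e :: nat \<Rightarrow> 'b::{complex_inner, complete_space}).
       (\<nexists>B :: 'b set. finite B \<and> cspan B = UNIV) \<and>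
       separable_space (euclidean :: 'b topology) \<and>
       corthonormal_basis {1..} e \<longrightarrow>
       (\<forall>(xs :: nat \<Rightarrow> 'b) (x :: 'b).
         xs \<longlonglongrightarrow> x \<longleftrightarrow>
           (\<forall>k\<ge>1. (\<lambda>n. cinner (xs n) (e k)) \<longlonglongrightarrow> cinner x (e k)) \<and>
           (\<forall>\<epsilon>>0. \<exists>K\<ge>1. \<forall>n\<ge>1. (\<Sum>\<^sub>\<infinity>k\<in>{K+1..}. (cmod (cinner (xs n) (e k)))\<^sup>2) < \<epsilon>)))"
proof (intro conjI allI impI; elim conjE)
  fix e :: "nat \<Rightarrow> 'a" and xs x
  assume "orthonormal_basis {1..} e"
  \<comment> \<open>\<open>span_raw_def\<close> identifies the real \<open>span\<close> with the
    locale's span taken at \<open>scaleR\<close>, as \<open>dense\<close> requires.\<close>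
  then interpret hermitian_basis_seq scaleR inner id e
    by (intro hermitian_basis_seq.intro hermitian_basis.intro hermitian_space_real
        hermitian_basis_axioms.intro) (auto simp: orthonormal_basis_def span_raw_def)
  show "xs \<longlonglongrightarrow> x \<longleftrightarrow>
      (\<forall>k\<ge>1. (\<lambda>n. inner (xs n) (e k)) \<longlonglongrightarrow> inner x (e k)) \<and>
      (\<forall>\<epsilon>>0. \<exists>K\<ge>1. \<forall>n\<ge>1. (\<Sum>\<^sub>\<infinity>k\<in>{K+1..}. \<bar>inner (xs n) (e k)\<bar>\<^sup>2) < \<epsilon>)"
    using tendsto_iff unfolding real_norm_def .
next
  fix e :: "nat \<Rightarrow> 'b" and xs x
  assume "corthonormal_basis {1..} e"
  then interpret hermitian_basis_seq scaleC cinner cnj e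
    by (intro hermitian_basis_seq.intro hermitian_basis.intro hermitian_space_complex
        hermitian_basis_axioms.intro) (auto simp: corthonormal_basis_def cspan_def)
  show "xs \<longlonglongrightarrow> x \<longleftrightarrow>
      (\<forall>k\<ge>1. (\<lambda>n. cinner (xs n) (e k)) \<longlonglongrightarrow> cinner x (e k)) \<and>
      (\<forall>\<epsilon>>0. \<exists>K\<ge>1. \<forall>n\<ge>1. (\<Sum>\<^sub>\<infinity>k\<in>{K+1..}. (cmod (cinner (xs n) (e k)))\<^sup>2) < \<epsilon>)"
    using tendsto_iff .
qed

end
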